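(* For every $r \in \mathbb{N}$, $f(r) \leq 1.5r^2 + r + 1$. That is, every strongly connected bridgeless mixed multigraph of radius $r$ admits an orientation that is a strongly connected digraph of radius at most $1.5r^2 + r + 1$.
   Context: A mixed multigraph is a finite multigraph in which each edge may be either directed or undirected. A walk from $v_1$ to $v_k$ is a sequence of vertices $v_1,\dots,v_k$ such that for each $i \in \{1,\dots,k-1\}$ there is either an undirected edge $\{v_i,v_{i+1}\}$ or an edge directed from $v_i$ to $v_{i+1}$. A trail is a walk without repeated edges; a path is a trail without repeated vertices, except possibly $v_1=v_k$. The length of a path is its number of edges (directed and undirected). A mixed multigraph is strongly connected if there is a path from each vertex to every other vertex. A bridge in a strongly connected mixed multigraph is an undirected edge whose removal makes the graph no longer strongly connected; the graph is bridgeless if it has no bridge. An orientation of a mixed multigraph $G$ is an assignment of exactly one direction to each undirected edge of $G$ (directed edges keep their direction); the result is a directed multigraph. The distance $d_G(u,v)$ is the length of a shortest path from $u$ to $v$. The eccentricity of a vertex $u$ is $e(u)=\max\{\max_{v} d_G(u,v),\ \max_{v} d_G(v,u)\}$, and the radius of $G$ is $\min_{u\in V(G)} e(u)$ (infinite if $G$ is not strongly connected). These notions apply in particular to directed multigraphs. For $r\in\mathbb{N}$, $f(r)$ denotes the smallest number such that every strongly connected bridgeless mixed multigraph of radius $r$ has an orientation that is a strongly connected digraph of radius at most $f(r)$. *)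

theory Defs
  imports Complex_Main "HOL-Library.Extended_Real"
begin

text \<open>
  Directed and undirected edges are identified by names, so parallel edges are allowed; so are
  loops. The fields \<open>tail\<close> and \<open>head\<close> are relevant only on \<open>darcs\<close>, the field \<open>ends\<close> only on
  \<open>uedges\<close>. A directed multigraph is a mixed multigraph with \<open>uedges = {}\<close>.
\<close>

record ('v, 'e) pre_mixed_multigraph =
  verts :: "'v set"
  darcs :: "'e set"
  uedges :: "'e set"
  tail :: "'e \<Rightarrow> 'v"
  head :: "'e \<Rightarrow> 'v"
  ends :: "'e \<Rightarrow> 'v set"

locale mixed_multigraph =
  fixes G :: "('v, 'e) pre_mixed_multigraph"
  assumes verts_finite: "finite (verts G)"
    and verts_nonempty: "verts G \<noteq> {}"
    and darcs_finite: "finite (darcs G)"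
    and uedges_finite: "finite (uedges G)"
    and darcs_uedges_disjoint: "darcs G \<inter> uedges G = {}"
    and tail_in_verts: "e \<in> darcs G \<Longrightarrow> tail G e \<in> verts G"
    and head_in_verts: "e \<in> darcs G \<Longrightarrow> head G e \<in> verts G"
    and ends_in_verts: "e \<in> uedges G \<Longrightarrow> \<exists>u\<in>verts G. \<exists>v\<in>verts G. ends G e = {u, v}"

definition traverses :: "('v, 'e) pre_mixed_multigraph \<Rightarrow> 'e \<Rightarrow> 'v \<Rightarrow> 'v \<Rightarrow> bool" where
  "traverses G e u v \<longleftrightarrow>
     e \<in> uedges G \<and> ends G e = {u, v} \<or> e \<in> darcs G \<and> tail G e = u \<and> head G e = v"

text \<open>
  In a multigraph the vertex sequence of a walk does not determine the edges used, which matters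
  for trails; a walk is therefore represented by its vertices together with its edges.
\<close>

definition is_walk :: "('v, 'e) pre_mixed_multigraph \<Rightarrow> 'v list \<Rightarrow> 'e list \<Rightarrow> bool" where
  "is_walk G vs es \<longleftrightarrow>
     set vs \<subseteq> verts G \<and> length vs = Suc (length es) \<and>
     (\<forall>i<length es. traverses G (es ! i) (vs ! i) (vs ! Suc i))"

definition is_trail :: "('v, 'e) pre_mixed_multigraph \<Rightarrow> 'v list \<Rightarrow> 'e list \<Rightarrow> bool" where
  "is_trail G vs es \<longleftrightarrow> is_walk G vs es \<and> distinct es"

text \<open>The only repetition of vertices that is permitted on a path is first = last.\<close>

definition is_path :: "('v, 'e) pre_mixed_multigraph \<Rightarrow> 'v list \<Rightarrow> 'e list \<Rightarrow> bool" where
  "is_path G vs es \<longleftrightarrow> is_trail G vs es \<and> distinct (butlast vs) \<and> distinct (tl vs)"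

definition path_from_to ::
  "('v, 'e) pre_mixed_multigraph \<Rightarrow> 'v \<Rightarrow> 'v list \<Rightarrow> 'e list \<Rightarrow> 'v \<Rightarrow> bool" where
  "path_from_to G u vs es v \<longleftrightarrow> is_path G vs es \<and> hd vs = u \<and> last vs = v"

definition strongly_connected :: "('v, 'e) pre_mixed_multigraph \<Rightarrow> bool" where
  "strongly_connected G \<longleftrightarrow>
     (\<forall>u\<in>verts G. \<forall>v\<in>verts G. u \<noteq> v \<longrightarrow> (\<exists>vs es. path_from_to G u vs es v))"

definition del_uedge ::
  "('v, 'e) pre_mixed_multigraph \<Rightarrow> 'e \<Rightarrow> ('v, 'e) pre_mixed_multigraph" where
  "del_uedge G e = G\<lparr>uedges := uedges G - {e}\<rparr>"

definition is_bridge :: "('v, 'e) pre_mixed_multigraph \<Rightarrow> 'e \<Rightarrow> bool" where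
  "is_bridge G e \<longleftrightarrow> e \<in> uedges G \<and> \<not> strongly_connected (del_uedge G e)"

definition bridgeless :: "('v, 'e) pre_mixed_multigraph \<Rightarrow> bool" where
  "bridgeless G \<longleftrightarrow> (\<nexists>e. is_bridge G e)"

definition is_orientation ::
  "('v, 'e) pre_mixed_multigraph \<Rightarrow> ('v, 'e) pre_mixed_multigraph \<Rightarrow> bool" where
  "is_orientation G H \<longleftrightarrow>
     verts H = verts G \<and> uedges H = {} \<and> darcs H = darcs G \<union> uedges G \<and>
     (\<forall>e\<in>darcs G. tail H e = tail G e \<and> head H e = head G e) \<and>
     (\<forall>e\<in>uedges G. {tail H e, head H e} = ends G e)"

text \<open>
  The distance is \<open>\<infinity>\<close> if there is no path (the infimum of the empty set), so eccentricities and
  the radius are \<open>\<infinity>\<close> if the graph is not strongly connected.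
\<close>

definition distance :: "('v, 'e) pre_mixed_multigraph \<Rightarrow> 'v \<Rightarrow> 'v \<Rightarrow> enat" where
  "distance G u v = Inf {enat (length es) | vs es. path_from_to G u vs es v}"

definition eccentricity :: "('v, 'e) pre_mixed_multigraph \<Rightarrow> 'v \<Rightarrow> enat" where
  "eccentricity G u =
     max (SUP v\<in>verts G. distance G u v) (SUP v\<in>verts G. distance G v u)"

definition radius :: "('v, 'e) pre_mixed_multigraph \<Rightarrow> enat" where
  "radius G = (INF u\<in>verts G. eccentricity G u)"

text \<open>
  Every finite mixed multigraph is isomorphic to one whose vertices and edges are natural
  numbers, so it suffices to range over those. The value is \<open>\<infinity>\<close> if no number \<open>k\<close> qualifies.
\<close>

definition oriented_radius_bound :: "nat \<Rightarrow> enat" where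
  "oriented_radius_bound r =
     Inf {enat k | k. \<forall>G :: (nat, nat) pre_mixed_multigraph.
            mixed_multigraph G \<and> strongly_connected G \<and> bridgeless G \<and> radius G = enat r \<longrightarrow>
            (\<exists>H. is_orientation G H \<and> strongly_connected H \<and> radius H \<le> enat k)}"

end

theory Submission
  imports Defs
begin

text \<open>
  Fix a vertex \<open>u\<close> of eccentricity \<open>r\<close>. Every undirected edge at \<open>u\<close> lies on a directed closed walk
  of length at most \<open>2 r + 1\<close>, but possibly in one direction only. Direct away from \<open>u\<close> a maximal
  set of edges at \<open>u\<close> whose other ends can still return within \<open>2 r\<close> steps, including all edges
  that cannot be directed towards \<open>u\<close>. Together with shortest return paths this gives a strongly
  connected oriented part with distances from and to \<open>u\<close> at most \<open>2 r\<close>. By maximality, every other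
  neighbour of \<open>u\<close> is within \<open>2 r - 1\<close> steps of this part, so it can be attached by a shortest path
  to it and an edge directed towards \<open>u\<close>. Thus \<open>u\<close> and its neighbours lie in an oriented part with
  distances at most \<open>4 r - 1\<close> from \<open>u\<close> and \<open>2 r\<close> to \<open>u\<close>; by reversal the two bounds may be
  exchanged. Contracting this part to \<open>u\<close> decreases the eccentricity of \<open>u\<close>. Distributing the
  larger bounds evenly between the two directions gives \<open>3 i\<close> on average for eccentricity \<open>i\<close>, up to
  lower order terms, instead of \<open>4 i\<close>.
\<close>

section \<open>Arc sets\<close>

type_synonym ('v, 'e) arcs = "('e \<times> 'v \<times> 'v) set"

text \<open>
  A mixed multigraph is encoded by the set of its traversals \<open>(e, a, b)\<close>: an undirected edge
  contributes both \<open>(e, a, b)\<close> and \<open>(e, b, a)\<close>.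
\<close>

primrec reach :: "('v, 'e) arcs \<Rightarrow> nat \<Rightarrow> 'v \<Rightarrow> 'v \<Rightarrow> bool" where
  "reach M 0 a b \<longleftrightarrow> a = b"
| "reach M (Suc n) a b \<longleftrightarrow> a = b \<or> (\<exists>e c. (e, a, c) \<in> M \<and> reach M n c b)"

definition reversal :: "('v, 'e) arcs \<Rightarrow> ('v, 'e) arcs" where
  "reversal M = {(e, a, b). (e, b, a) \<in> M}"

definition avoid_edge :: "('v, 'e) arcs \<Rightarrow> 'e \<Rightarrow> ('v, 'e) arcs" where
  "avoid_edge M e = {(f, a, b) \<in> M. f \<noteq> e}"

definition avoid_vertex :: "('v, 'e) arcs \<Rightarrow> 'v \<Rightarrow> ('v, 'e) arcs" where
  "avoid_vertex M u = {(f, a, b) \<in> M. a \<noteq> u \<and> b \<noteq> u}"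

text \<open>A consistent subset of the arcs of a mixed multigraph extends to an orientation; a loop
  equals its own reversal and cannot conflict.\<close>

definition consistent :: "('v, 'e) arcs \<Rightarrow> bool" where
  "consistent K \<longleftrightarrow> (\<forall>e a b. (e, a, b) \<in> K \<and> (e, b, a) \<in> K \<longrightarrow> a = b)"

section \<open>Walks of bounded length and their reversal\<close>

lemma reach_refl [simp]: "reach M n a a"
  by (cases n) auto

lemma reach_mono: "reach M n a b \<Longrightarrow> M \<subseteq> N \<Longrightarrow> n \<le> m \<Longrightarrow> reach N m a b"
proof (induction n arbitrary: a m)
  case (Suc n)
  obtain k where k: "m = Suc k" "n \<le> k" using Suc.prems(3) by (cases m) auto
  with Suc.IH[of _ k] Suc.prems show ?case by auto
qed auto

lemma reach_trans: "reach M n a b \<Longrightarrow> reach M m b c \<Longrightarrow> reach M (n + m) a c"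
proof (induction n arbitrary: a)
  case (Suc n)
  then show ?case
    using reach_mono[OF Suc.prems(2) subset_refl, of "Suc (n + m)"] by auto
qed auto

lemma reach_arc: "(e, a, b) \<in> M \<Longrightarrow> reach M 1 a b"
  by auto

lemma reach_Cons: "(e, a, b) \<in> M \<Longrightarrow> reach M n b c \<Longrightarrow> reach M (Suc n) a c"
  by auto

lemma reach_snoc: "reach M n a b \<Longrightarrow> (e, b, c) \<in> M \<Longrightarrow> reach M (Suc n) a c"
  using reach_trans[of M n a b 1 c] reach_arc[of e b c M] by simp

lemma reversal_iff [simp]: "(e, a, b) \<in> reversal M \<longleftrightarrow> (e, b, a) \<in> M"
  by (simp add: reversal_def)

lemma reversal_reversal [simp]: "reversal (reversal M) = M"
  by (auto simp: reversal_def)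

lemma reversal_mono: "M \<subseteq> N \<Longrightarrow> reversal M \<subseteq> reversal N"
  by (auto simp: reversal_def)

lemma avoid_edge_iff [simp]: "(f, a, b) \<in> avoid_edge M e \<longleftrightarrow> (f, a, b) \<in> M \<and> f \<noteq> e"
  by (simp add: avoid_edge_def)

lemma avoid_vertex_iff [simp]:
  "(f, a, b) \<in> avoid_vertex M u \<longleftrightarrow> (f, a, b) \<in> M \<and> a \<noteq> u \<and> b \<noteq> u"
  by (simp add: avoid_vertex_def)

lemma avoid_edge_reversal: "avoid_edge (reversal M) e = reversal (avoid_edge M e)"
  by (auto simp: avoid_edge_def reversal_def)

lemma avoid_vertex_reversal: "avoid_vertex (reversal M) u = reversal (avoid_vertex M u)"
  by (auto simp: avoid_vertex_def reversal_def)

lemma reach_reversal_imp: "reach M n a b \<Longrightarrow> reach (reversal M) n b a"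
proof (induction n arbitrary: a)
  case (Suc n)
  show ?case
  proof (cases "a = b")
    case False
    then obtain e c where "(e, a, c) \<in> M" "reach M n c b" using Suc.prems by auto
    then show ?thesis using Suc.IH reach_snoc[of "reversal M" n b c e a] by simp
  qed simp
qed auto

lemma reach_reversal [simp]: "reach (reversal M) n a b \<longleftrightarrow> reach M n b a"
  using reach_reversal_imp[of M n b a] reach_reversal_imp[of "reversal M" n a b] by auto

lemma consistent_reversal: "consistent (reversal K) \<longleftrightarrow> consistent K"
  by (auto simp: consistent_def)

lemma finite_reversal: "finite M \<Longrightarrow> finite (reversal M)"
proof -
  assume "finite M"
  moreover have "reversal M = (\<lambda>(e, a, b). (e, b, a)) ` M"
    by (force simp: reversal_def)
  ultimately show ?thesis by simp
qed

text \<open>Cut the walk at its first visit to \<open>u\<close>; the part before the last arc avoids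
  \<open>u\<close> and is one step shorter.\<close>

lemma reach_first_arrival:
  assumes "reach M n a u" "a \<noteq> u"
  shows "\<exists>m y f. n = Suc m \<and> (f, y, u) \<in> M \<and> y \<noteq> u \<and> reach (avoid_vertex M u) m a y"
  using assms
proof (induction n arbitrary: a)
  case (Suc n)
  then obtain e c where c: "(e, a, c) \<in> M" "reach M n c u" by auto
  show ?case
  proof (cases "c = u")
    case True
    then show ?thesis using c Suc.prems by (intro exI[of _ n] exI[of _ a] exI[of _ e]) simp
  next
    case False
    from Suc.IH[OF c(2) False] obtain m y f where
      m: "n = Suc m" "(f, y, u) \<in> M" "y \<noteq> u" "reach (avoid_vertex M u) m c y" by blast
    have "reach (avoid_vertex M u) (Suc m) a y"
      using reach_Cons[of e a c "avoid_vertex M u" m y] c m False Suc.prems by simp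
    then show ?thesis using m by blast
  qed
qed auto

lemma reach_last_departure:
  assumes "reach M n u b" "b \<noteq> u"
  shows "\<exists>m y f. n = Suc m \<and> (f, u, y) \<in> M \<and> y \<noteq> u \<and> reach (avoid_vertex M u) m y b"
  using reach_first_arrival[of "reversal M" n b u] assms by (simp add: avoid_vertex_reversal)

section \<open>Unions of shortest paths to a target set\<close>

text \<open>\<open>K\<close> may branch. What matters is that \<delta> drops by one along each arc,
  so that \<open>K\<close> contains no arc together with its reversal. The last clause bounds a
  whole path from \<open>B\<close> through \<open>y\<close> to \<open>T\<close> by
  \<open>k\<close>.\<close>

definition shortest_path_forest ::
  "('v, 'e) arcs \<Rightarrow> 'v set \<Rightarrow> 'v set \<Rightarrow> nat \<Rightarrow> ('v, 'e) arcs \<Rightarrow> 'v set \<Rightarrow> ('v \<Rightarrow> nat) \<Rightarrow> bool"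
where
  "shortest_path_forest N B T k K Y \<delta> \<longleftrightarrow>
     K \<subseteq> N \<and> B \<subseteq> Y \<and>
     (\<forall>e a b. (e, a, b) \<in> K \<longrightarrow> a \<in> Y \<and> b \<in> Y \<and> \<delta> a = Suc (\<delta> b)) \<and>
     (\<forall>y\<in>Y. \<delta> y = 0 \<longleftrightarrow> y \<in> T) \<and>
     (\<forall>y\<in>Y. \<exists>t\<in>T. reach K (\<delta> y) y t) \<and>
     (\<forall>y\<in>Y. \<exists>b\<in>B. \<exists>i. reach K i b y \<and> i + \<delta> y \<le> k)"

lemma shortest_path_forestD:
  assumes "shortest_path_forest N B T k K Y \<delta>"
  shows "K \<subseteq> N" "B \<subseteq> Y"
    and "(e, a, b) \<in> K \<Longrightarrow> a \<in> Y \<and> b \<in> Y \<and> \<delta> a = Suc (\<delta> b)"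
    and "y \<in> Y \<Longrightarrow> \<delta> y = 0 \<longleftrightarrow> y \<in> T"
    and "y \<in> Y \<Longrightarrow> \<exists>t\<in>T. reach K (\<delta> y) y t"
    and "y \<in> Y \<Longrightarrow> \<exists>b\<in>B. \<exists>i. reach K i b y \<and> i + \<delta> y \<le> k"
  using assms by (simp_all add: shortest_path_forest_def)

lemma shortest_path_forest_exists:
  fixes N :: "('v, 'e) arcs"
  assumes "\<And>b. b \<in> B \<Longrightarrow> \<exists>t\<in>T. reach N k b t"
  shows "\<exists>K Y \<delta>. shortest_path_forest N B T k K Y \<delta>"
proof -
  define near where "near n w \<longleftrightarrow> (\<exists>t\<in>T. reach N n w t)" for n w
  define \<delta> where "\<delta> w = (LEAST n. near n w)" for w
  \<comment> \<open>\<open>E\<close> collects the tight steps. Since \<delta> is unspecified at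
    vertices that cannot reach \<open>T\<close>, the condition \<open>near n b\<close> is imposed as
    well.\<close>
  define E where "E = {(a, b). \<exists>e n. (e, a, b) \<in> N \<and> near n b \<and> \<delta> a = Suc (\<delta> b)}"
  define Y where "Y = E\<^sup>* `` B"
  define K where "K = {(e, a, b) \<in> N. a \<in> Y \<and> (a, b) \<in> E}"
  have near_\<delta>: "near (\<delta> w) w" if "near n w" for n w
    unfolding \<delta>_def using that by (rule LeastI)
  have \<delta>_le: "\<delta> w \<le> n" if "near n w" for n w
    unfolding \<delta>_def using that by (rule Least_le)
  have nearY: "near (\<delta> y) y" if y: "y \<in> Y" for y
  proof -
    obtain b where b: "b \<in> B" "(b, y) \<in> E\<^sup>*" using y unfolding Y_def by blast
    from b(2) show ?thesis
    proof (cases rule: rtranclE)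
      case base
      then show ?thesis using assms b near_\<delta> near_def by blast
    next
      case (step c)
      then show ?thesis using near_\<delta> by (auto simp: E_def)
    qed
  qed
  \<comment> \<open>The first arc of a shortest walk to \<open>T\<close> is tight.\<close>
  have succ: "\<exists>e b. (e, a, b) \<in> N \<and> (a, b) \<in> E" if a: "a \<in> Y" "\<delta> a = Suc n" for a n
  proof -
    from nearY[OF a(1)] obtain t where t: "t \<in> T" "reach N (Suc n) a t"
      using a(2) by (auto simp: near_def)
    have "a \<noteq> t"
    proof
      assume "a = t"
      then have "near 0 a" using t by (auto simp: near_def)
      then show False using \<delta>_le[of 0 a] a by simp
    qed
    then obtain e c where c: "(e, a, c) \<in> N" "reach N n c t" using t by auto
    then have nc: "near n c" using t by (auto simp: near_def)
    then obtain t' where "t' \<in> T" "reach N (\<delta> c) c t'" using near_\<delta> near_def by blast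
    then have "near (Suc (\<delta> c)) a" using c by (auto simp: near_def)
    then have "Suc n \<le> Suc (\<delta> c)" using \<delta>_le a by metis
    with \<delta>_le[OF nc] have "\<delta> a = Suc (\<delta> c)" using a by simp
    then show ?thesis using c nc by (auto simp: E_def)
  qed
  have YE: "b \<in> Y" if "a \<in> Y" "(a, b) \<in> E" for a b
    using that by (auto simp: Y_def intro: rtrancl_into_rtrancl)
  have "\<exists>t\<in>T. reach K (\<delta> y) y t" if "y \<in> Y" for y
    using that
  proof (induction "\<delta> y" arbitrary: y)
    case 0
    then show ?case using nearY[of y] by (auto simp: near_def)
  next
    case (Suc n)
    obtain e b where b: "(e, y, b) \<in> N" "(y, b) \<in> E"
      using succ Suc.prems Suc.hyps(2) by metis
    then have "\<delta> y = Suc (\<delta> b)" "b \<in> Y" "(e, y, b) \<in> K"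
      using YE Suc.prems by (auto simp: E_def K_def)
    then show ?case using Suc.hyps(1)[of b] Suc.hyps(2) by auto
  qed
  moreover have "\<exists>b\<in>B. \<exists>i. reach K i b y \<and> i + \<delta> y \<le> k" if y: "y \<in> Y" for y
  proof -
    obtain b where b: "b \<in> B" "(b, y) \<in> E\<^sup>*" using y unfolding Y_def by blast
    \<comment> \<open>Along tight arcs \<open>i + \<delta> y\<close> stays constant, and it starts
      at \<open>\<delta> b \<le> k\<close>.\<close>
    from b(2) have "\<exists>i. reach K i b y \<and> i + \<delta> y \<le> k"
    proof induction
      case base
      have "\<delta> b \<le> k" using assms[OF b(1)] \<delta>_le by (auto simp: near_def)
      then show ?case by (intro exI[of _ 0]) simp
    next
      case (step y z)
      then obtain i where i: "reach K i b y" "i + \<delta> y \<le> k" by blast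
      have "y \<in> Y" using step b by (auto simp: Y_def)
      then obtain e where "(e, y, z) \<in> K" "\<delta> y = Suc (\<delta> z)"
        using step by (auto simp: E_def K_def)
      then show ?case using reach_snoc[OF i(1)] i(2) by (intro exI[of _ "Suc i"]) auto
    qed
    then show ?thesis using b by blast
  qed
  moreover have "\<delta> y = 0 \<longleftrightarrow> y \<in> T" if y: "y \<in> Y" for y
  proof
    assume "\<delta> y = 0"
    then show "y \<in> T" using nearY[OF y] by (auto simp: near_def)
  next
    assume "y \<in> T"
    then have "near 0 y" by (auto simp: near_def)
    then show "\<delta> y = 0" using \<delta>_le by fastforce
  qed
  moreover have "a \<in> Y \<and> b \<in> Y \<and> \<delta> a = Suc (\<delta> b)" if "(e, a, b) \<in> K" for e a b
    using that YE by (auto simp: K_def E_def)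
  moreover have "K \<subseteq> N" "B \<subseteq> Y" by (auto simp: K_def Y_def)
  ultimately have "shortest_path_forest N B T k K Y \<delta>"
    unfolding shortest_path_forest_def by blast
  then show ?thesis by blast
qed

section \<open>Absorbing the neighbourhood of the root\<close>

text \<open>\<open>r\<close> is an upper bound for the eccentricity of \<open>u\<close>, so that the
  locale passes to contractions with a smaller bound.\<close>

locale rooted_mixed =
  fixes M :: "('v, 'e) arcs" and V :: "'v set" and u :: 'v and r :: nat
  assumes finite_arcs: "finite M"
    and root: "u \<in> V"
    and arc_ends: "(e, a, b) \<in> M \<Longrightarrow> a \<in> V \<and> b \<in> V"
    and mixed: "(e, a, b) \<in> M \<Longrightarrow> (e, a', b') \<in> M \<Longrightarrow> (a', b') = (a, b) \<or> (a', b') = (b, a)"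
    and out_ecc: "w \<in> V \<Longrightarrow> reach M r u w"
    and in_ecc: "w \<in> V \<Longrightarrow> reach M r w u"
    and no_bridge: "(e, a, b) \<in> M \<Longrightarrow> (e, b, a) \<in> M \<Longrightarrow> \<exists>n. reach (avoid_edge M e) n a b"

lemma (in rooted_mixed) rooted_mixed_reversal: "rooted_mixed (reversal M) V u r"
proof
  show "finite (reversal M)" using finite_arcs by (rule finite_reversal)
  show "\<exists>n. reach (avoid_edge (reversal M) e) n a b"
    if "(e, a, b) \<in> reversal M" "(e, b, a) \<in> reversal M" for e a b
    using that no_bridge[of e b a] by (simp add: avoid_edge_reversal)
qed (use root arc_ends out_ecc in_ecc mixed in \<open>fastforce+\<close>)

section \<open>Short closed walks through an edge at the root\<close>

text \<open>Follow the walk until it first meets an end of \<open>e\<close>; no arc before that is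
  \<open>e\<close>. If this end is \<open>v\<close> and not \<open>u\<close>, at least one step is
  still left, whence the saving of one.\<close>

lemma (in rooted_mixed) to_root_avoiding:
  assumes "reach M n w u" "(e, u, v) \<in> M"
  shows "reach (avoid_edge M e) n w u \<or> (\<exists>m. n = Suc m \<and> reach (avoid_edge M e) m w v)"
  using assms(1)
proof (induction n arbitrary: w)
  case (Suc n)
  show ?case
  proof (cases "w = u \<or> w = v")
    case False
    then obtain f c where c: "(f, w, c) \<in> M" "reach M n c u" using Suc.prems by auto
    have "f \<noteq> e" using mixed[OF assms(2), of w c] c False by auto
    then have fc: "(f, w, c) \<in> avoid_edge M e" using c by simp
    from Suc.IH[OF c(2)] show ?thesis
      using reach_Cons[OF fc] by blast
  qed auto
qed auto

lemma (in rooted_mixed) from_root_avoiding: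
  assumes "reach M n u w" "(e, v, u) \<in> M"
  shows "reach (avoid_edge M e) n u w \<or> (\<exists>m. n = Suc m \<and> reach (avoid_edge M e) m v w)"
  using rooted_mixed.to_root_avoiding[OF rooted_mixed_reversal, of n w e v] assms
  by (simp add: avoid_edge_reversal)

lemma reach_exit:
  assumes "reach M n a b" "a \<in> A" "b \<notin> A"
  shows "\<exists>e x y. (e, x, y) \<in> M \<and> x \<in> A \<and> y \<notin> A"
  using assms by (induction n arbitrary: a) auto

text \<open>
  Consider where a walk from \<open>v\<close> to the root avoiding \<open>e\<close> leaves the set of vertices that are close
  to \<open>v\<close> in both directions.
\<close>

lemma (in rooted_mixed) short_cycle_through_root_edge:
  assumes "0 < r" "(e, u, v) \<in> M" "(e, v, u) \<in> M"
  shows "reach (avoid_edge M e) (2 * r) u v \<or> reach (avoid_edge M e) (2 * r) v u"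
proof (rule ccontr)
  assume contra: "\<not> ?thesis"
  define N where "N = avoid_edge M e"
  \<comment> \<open>The radius \<open>r - 1\<close> matches the step saved in
    \<open>to_root_avoiding\<close>: a vertex outside \<open>B\<close> reaches \<open>u\<close>
    without \<open>e\<close> in \<open>r\<close> steps, and one outside \<open>A\<close> is reached
    from \<open>u\<close> likewise.\<close>
  define A where "A = {w. reach N (r - 1) v w}"
  define B where "B = {w. reach N (r - 1) w v}"
  have "u \<notin> A" using contra reach_mono[of N "r - 1" v u N "2 * r"] assms(1) unfolding A_def N_def by force
  moreover obtain n where "reach N n v u"
    using no_bridge assms unfolding N_def by blast
  ultimately obtain f x y where xy: "(f, x, y) \<in> N" "x \<in> A \<inter> B" "y \<notin> A \<inter> B"
    using reach_exit[of N n v u "A \<inter> B"] by (auto simp: A_def B_def)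
  have yV: "y \<in> V" using arc_ends xy by (auto simp: N_def)
  have vy: "reach N r v y"
    using reach_snoc[of N "r - 1" v x f y] xy assms(1) by (auto simp: A_def)
  show False
  \<comment> \<open>Either \<open>v\<close> reaches \<open>u\<close> through \<open>y\<close> in
    \<open>r + r\<close> steps, or \<open>u\<close> reaches \<open>v\<close> through
    \<open>y\<close> in \<open>r + (r - 1)\<close> steps.\<close>
  proof (cases "y \<in> B")
    case False
    then have "\<not> (\<exists>m. r = Suc m \<and> reach N m y v)" by (auto simp: B_def)
    then have "reach N r y u"
      using to_root_avoiding[OF in_ecc[OF yV] assms(2)] by (auto simp: N_def)
    then show False using reach_trans[OF vy] contra by (simp add: N_def mult_2)
  next
    case True
    then have "\<not> (\<exists>m. r = Suc m \<and> reach N m v y)" using xy by (auto simp: A_def)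
    then have "reach N r u y"
      using from_root_avoiding[OF out_ecc[OF yV] assms(3)] by (auto simp: N_def)
    then have "reach N (r + (r - 1)) u v"
      using reach_trans True by (fastforce simp: B_def)
    then show False using contra reach_mono[of N "r + (r - 1)" u v N "2 * r"] by (auto simp: N_def)
  qed
qed

section \<open>Directing edges at the root outwards\<close>

context rooted_mixed
begin

definition root_uedges :: "'e set" where
  "root_uedges = {e. \<exists>v. v \<noteq> u \<and> (e, u, v) \<in> M \<and> (e, v, u) \<in> M}"

text \<open>Undirected edges outside \<open>S\<close> keep both arcs, as their direction is not yet
  chosen.\<close>

definition orient_out :: "'e set \<Rightarrow> ('v, 'e) arcs" where
  "orient_out S = {(e, a, b) \<in> M. \<not> (e \<in> S \<and> b = u)}"

text \<open>The arcs that can only be used to leave \<open>u\<close>: directed ones and those of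
  edges in \<open>S\<close>.\<close>

definition out_arcs :: "'e set \<Rightarrow> ('v, 'e) arcs" where
  "out_arcs S = {(e, a, b) \<in> M. a = u \<and> b \<noteq> u \<and> (e, b, u) \<notin> orient_out S}"

definition admissible :: "'e set \<Rightarrow> bool" where
  "admissible S \<longleftrightarrow> (\<forall>(e, a, b) \<in> out_arcs S. reach (orient_out S) (2 * r) b u)"

text \<open>Directed towards \<open>u\<close>, such an edge would lie on no closed walk of length at
  most \<open>2 * r + 1\<close>.\<close>

definition forced_out :: "'e set" where
  "forced_out = {e \<in> root_uedges. \<forall>v. (e, u, v) \<in> M \<longrightarrow> \<not> reach (avoid_edge M e) (2 * r) u v}"

lemma finite_root_uedges: "finite root_uedges"
proof (rule finite_subset)
  show "root_uedges \<subseteq> fst ` M" by (force simp: root_uedges_def)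
qed (use finite_arcs in simp)

lemma root_uedgesD:
  assumes "e \<in> root_uedges" "(e, a, b) \<in> M"
  shows "a \<noteq> b \<and> (a = u \<or> b = u) \<and> (e, b, a) \<in> M"
  using assms mixed unfolding root_uedges_def by fastforce

lemma orient_out_iff [simp]:
  "(e, a, b) \<in> orient_out S \<longleftrightarrow> (e, a, b) \<in> M \<and> \<not> (e \<in> S \<and> b = u)"
  by (simp add: orient_out_def)

lemma out_arcs_iff [simp]:
  "(e, a, b) \<in> out_arcs S \<longleftrightarrow>
     (e, a, b) \<in> M \<and> a = u \<and> b \<noteq> u \<and> (e, b, u) \<notin> orient_out S"
  by (auto simp: out_arcs_def)

text \<open>The head \<open>b\<close> of an out-arc \<open>e\<close> returns to \<open>u\<close>
  within \<open>2 * r\<close> steps, by the short closed walk if \<open>e\<close> is forced out and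
  by the eccentricity otherwise. Were the last edge \<open>f\<close> of the return forced out, then
  \<open>e\<close> followed by the rest of the return would reach the other end of \<open>f\<close>
  within \<open>2 * r\<close> steps without \<open>f\<close>, a contradiction.\<close>

lemma admissible_forced_out:
  assumes "0 < r"
  shows "admissible forced_out"
proof -
  have "reach (orient_out forced_out) (2 * r) b u"
    if e: "(e, u, b) \<in> M" "b \<noteq> u" "(e, b, u) \<in> M \<longrightarrow> e \<in> forced_out" for e b
  proof -
    have "\<exists>N \<subseteq> M. reach N (2 * r) b u \<and> ((e, b, u) \<in> M \<longrightarrow> N = avoid_edge M e)"
    proof (cases "(e, b, u) \<in> M")
      case True
      then have "\<not> reach (avoid_edge M e) (2 * r) u b" using e by (simp add: forced_out_def)
      then have "reach (avoid_edge M e) (2 * r) b u"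
        using short_cycle_through_root_edge assms e(1) True by blast
      then show ?thesis by (intro exI[of _ "avoid_edge M e"]) (auto simp: avoid_edge_def)
    next
      case False
      then show ?thesis using in_ecc[of b] arc_ends[OF e(1)] reach_mono[of M r b u M "2 * r"] by auto
    qed
    then obtain N where N: "N \<subseteq> M" "reach N (2 * r) b u" "(e, b, u) \<in> M \<longrightarrow> N = avoid_edge M e"
      by blast
    from reach_first_arrival[OF N(2) e(2)] obtain m y f where
      m: "2 * r = Suc m" "(f, y, u) \<in> N" "y \<noteq> u" "reach (avoid_vertex N u) m b y" by blast
    have fM: "(f, y, u) \<in> M" using m N by blast
    have "f \<notin> forced_out"
    proof
      assume f: "f \<in> forced_out"
      then have fU: "f \<in> root_uedges" by (simp add: forced_out_def)
      then have fuy: "(f, u, y) \<in> M" using root_uedgesD fM by blast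
      have "f \<noteq> e" using m(2) N(3) root_uedgesD[OF fU, of u b] e(1) by auto
      moreover have "avoid_vertex N u \<subseteq> avoid_edge M f"
        using N(1) root_uedgesD[OF fU] by (fastforce simp: avoid_vertex_def avoid_edge_def)
      ultimately have "reach (avoid_edge M f) (Suc m) u y"
        using reach_Cons[of e u b "avoid_edge M f" m y] reach_mono[OF m(4)] e(1) by simp
      then show False using f fuy m(1) by (auto simp: forced_out_def)
    qed
    moreover have "avoid_vertex N u \<subseteq> orient_out forced_out"
      using N(1) by (auto simp: avoid_vertex_def)
    ultimately have "reach (orient_out forced_out) (Suc m) b u"
      using reach_snoc[OF reach_mono[OF m(4)], of "orient_out forced_out" m f u] fM by simp
    then show ?thesis using m(1) by simp
  qed
  then show ?thesis by (auto simp: admissible_def)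
qed

text \<open>
  A maximal admissible set \<open>S\<close> plays the role of the complement of a quasi-kernel: any neighbour
  of the root that the shortest return paths of the out-arcs miss cannot be added to \<open>S\<close>, and
  this forces a short path to it that starts at a vertex already absorbed.
\<close>

lemma absorb_neighbourhood:
  assumes "0 < r"
  shows "\<exists>K X. K \<subseteq> M \<and> u \<in> X \<and> consistent K \<and>
    (\<forall>e a b. (e, a, b) \<in> K \<longrightarrow> a \<in> X \<and> b \<in> X) \<and>
    (\<forall>e a b. (e, a, b) \<in> M \<and> (a = u \<or> b = u) \<longrightarrow> a \<in> X \<and> b \<in> X) \<and>
    (\<forall>x\<in>X. reach K (4 * r - 1) u x \<and> reach K (2 * r) x u)"
proof -
  have "finite {S. S \<subseteq> root_uedges \<and> forced_out \<subseteq> S \<and> admissible S}"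
    using finite_root_uedges by auto
  moreover have "forced_out \<in> {S. S \<subseteq> root_uedges \<and> forced_out \<subseteq> S \<and> admissible S}"
    using admissible_forced_out assms by (auto simp: forced_out_def)
  ultimately obtain S where "S \<in> {S. S \<subseteq> root_uedges \<and> forced_out \<subseteq> S \<and> admissible S}"
    and S_max': "\<And>S'. S' \<in> {S. S \<subseteq> root_uedges \<and> forced_out \<subseteq> S \<and> admissible S} \<Longrightarrow> S \<subseteq> S' \<Longrightarrow> S = S'"
    by (meson finite_has_maximal2)
  then have S: "S \<subseteq> root_uedges" "forced_out \<subseteq> S" "admissible S"
    by auto
  have S_max: "\<not> admissible S'" if "S \<subset> S'" "S' \<subseteq> root_uedges" for S'
    using S_max'[of S'] S(2) that by auto
  define Bs where "Bs = {b. \<exists>e. (e, u, b) \<in> out_arcs S}"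
  have return: "\<exists>t\<in>{u}. reach (orient_out S) (2 * r) b t" if "b \<in> Bs" for b
    using that S(3) unfolding admissible_def Bs_def by blast
  obtain K1 Y \<delta> where forest: "shortest_path_forest (orient_out S) Bs {u} (2 * r) K1 Y \<delta>"
    using shortest_path_forest_exists[OF return] by blast
  note K1 = shortest_path_forestD[OF forest]
  have \<delta>_le: "\<delta> y \<le> 2 * r" if "y \<in> Y" for y using K1(6)[OF that] by auto
  \<comment> \<open>Otherwise \<open>insert e S\<close> would be admissible: the return paths in
    \<open>K1\<close> stay in \<open>Y\<close> and so never use the arc of \<open>e\<close> from
    \<open>y\<close> to \<open>u\<close>.\<close>
  have not_addable: "\<not> reach (avoid_edge (orient_out S) e) (2 * r) y u"
    if e: "e \<in> root_uedges" "e \<notin> S" "(e, u, y) \<in> M" "y \<notin> Y" for e y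
  proof
    assume *: "reach (avoid_edge (orient_out S) e) (2 * r) y u"
    let ?S = "insert e S"
    have "reach (orient_out ?S) (2 * r) b u"
      if f: "(f, u, b) \<in> M" "b \<noteq> u" "(f, b, u) \<in> M \<longrightarrow> f \<in> ?S" for f b
    proof (cases "f = e")
      case True
      then have "b = y" using mixed[OF e(3), of u b] f(1,2) by auto
      moreover have "avoid_edge (orient_out S) e \<subseteq> orient_out ?S" by (auto simp: avoid_edge_def)
      ultimately show ?thesis using reach_mono[OF *] by simp
    next
      case False
      then have "b \<in> Y" using f K1(2) by (auto simp: Bs_def)
      moreover have "K1 \<subseteq> orient_out ?S"
      proof clarify
        fix f a c assume f: "(f, a, c) \<in> K1"
        have "a = y" if "f = e" "c = u"
          using mixed[OF e(3), of a c] f K1(1) that by auto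
        then show "(f, a, c) \<in> orient_out ?S" using f K1(1,3) e(4) by auto
      qed
      ultimately show ?thesis using reach_mono[of K1 "\<delta> b" b u "orient_out ?S" "2 * r"] K1(5)[of b] \<delta>_le[of b] by auto
    qed
    then have "admissible ?S" by (auto simp: admissible_def)
    then show False using S_max[of ?S] S(1) e by auto
  qed
  define R where "R = {v. v \<noteq> u \<and> v \<notin> Y \<and> (\<exists>e. (e, u, v) \<in> M \<or> (e, v, u) \<in> M)}"
  have R_in: "\<exists>e. (e, v, u) \<in> M \<and> e \<notin> S" if v: "v \<in> R" for v
  proof -
    have "v \<notin> Bs" using v K1(2) by (auto simp: R_def)
    obtain e where "(e, u, v) \<in> M \<or> (e, v, u) \<in> M" using v by (auto simp: R_def)
    then show ?thesis
      using \<open>v \<notin> Bs\<close> v root_uedgesD[of e v u] S(1) by (auto simp: Bs_def R_def)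
  qed
  \<comment> \<open>Reversal turns paths from \<open>Y\<close> to \<open>R\<close> into paths
    towards a target set; avoiding \<open>u\<close> keeps them off the edges at the root.\<close>
  define N2 where "N2 = avoid_vertex (reversal M) u"
  have absorbed: "\<exists>t\<in>Y - {u}. reach N2 (2 * r - 1) v t" if v: "v \<in> R" for v
  proof -
    obtain e where e: "(e, v, u) \<in> M" "e \<notin> S" using R_in[OF v] by blast
    \<comment> \<open>An undirected \<open>e\<close> outside \<open>S\<close> is not forced out, so
      \<open>v\<close> can be reached without it; for a directed \<open>e\<close> the eccentricity
      suffices.\<close>
    have "\<exists>N\<subseteq>M. reach N (2 * r) u v \<and> (e \<in> root_uedges \<longrightarrow> N = avoid_edge M e)"
    proof (cases "e \<in> root_uedges")
      case True
      then obtain w where w: "(e, u, w) \<in> M" "reach (avoid_edge M e) (2 * r) u w"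
        using e(2) S(2) by (auto simp: forced_out_def)
      then have "w = v" using mixed[OF e(1) w(1)] v by (auto simp: R_def)
      then show ?thesis using w by (intro exI[of _ "avoid_edge M e"]) (auto simp: avoid_edge_def)
    next
      case False
      then show ?thesis
        using out_ecc[of v] arc_ends[OF e(1)] reach_mono[of M r u v M "2 * r"] by auto
    qed
    then obtain N where N: "N \<subseteq> M" "reach N (2 * r) u v" "e \<in> root_uedges \<longrightarrow> N = avoid_edge M e"
      by blast
    from v have "v \<noteq> u" by (simp add: R_def)
    from reach_last_departure[OF N(2) this] obtain m y f where
      m: "2 * r = Suc m" "(f, u, y) \<in> N" "y \<noteq> u" "reach (avoid_vertex N u) m y v" by blast
    have "avoid_vertex N u \<subseteq> avoid_vertex M u" using N(1) by (auto simp: avoid_vertex_def)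
    then have yv: "reach (avoid_vertex M u) m y v" using reach_mono[OF m(4)] by simp
    \<comment> \<open>Otherwise \<open>f\<close> is an undirected edge outside \<open>S\<close>, and
      the walk from \<open>y\<close> to \<open>v\<close> followed by \<open>e\<close> returns to
      \<open>u\<close> within \<open>2 * r\<close> steps without \<open>f\<close>, which
      \<open>not_addable\<close> excludes.\<close>
    have "y \<in> Y"
    proof (rule ccontr)
      assume y: "y \<notin> Y"
      have fM: "(f, u, y) \<in> M" using m N by blast
      then have "(f, y, u) \<in> orient_out S" using y K1(2) m(3) by (auto simp: Bs_def)
      then have f: "f \<in> root_uedges" "f \<notin> S" using fM m(3) by (auto simp: root_uedges_def)
      have "f \<noteq> e" using m(2) N(3) f(1) by auto
      moreover have "avoid_vertex M u \<subseteq> avoid_edge (orient_out S) f"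
        using root_uedgesD[OF f(1)] by (fastforce simp: avoid_vertex_def avoid_edge_def)
      ultimately have "reach (avoid_edge (orient_out S) f) (Suc m) y u"
        using reach_snoc[OF reach_mono[OF yv], of "avoid_edge (orient_out S) f" m e u] e by simp
      then show False using not_addable[OF f fM y] m(1) by simp
    qed
    moreover have "reach N2 (2 * r - 1) v y"
      using yv m(1) by (simp add: N2_def avoid_vertex_reversal)
    ultimately show ?thesis using m(3) by blast
  qed
  obtain K2 Z \<epsilon> where forest2: "shortest_path_forest N2 R (Y - {u}) (2 * r - 1) K2 Z \<epsilon>"
    using shortest_path_forest_exists[OF absorbed] by blast
  note K2 = shortest_path_forestD[OF forest2]
  define In where "In = {(e, a, b) \<in> M. a \<in> R \<and> b = u}"
  \<comment> \<open>Out-arcs and \<open>K1\<close> form closed walks through \<open>u\<close> that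
    cover \<open>Y\<close>; \<open>reversal K2\<close> and \<open>In\<close> lead from
    \<open>Y\<close> through \<open>Z\<close> back to \<open>u\<close>.\<close>
  define K where "K = out_arcs S \<union> K1 \<union> reversal K2 \<union> In"
  define X where "X = insert u (Y \<union> Z)"
  have K2_off: "a \<noteq> u \<and> b \<noteq> u \<and> (e, b, a) \<in> M \<and> a \<notin> Y" if "(e, a, b) \<in> K2" for e a b
    using K2(1) K2(3)[OF that] K2(4)[of a] that by (auto simp: N2_def)
  have In_iff: "(e, a, b) \<in> In \<longleftrightarrow> (e, a, b) \<in> M \<and> a \<in> R \<and> b = u" for e a b
    by (auto simp: In_def)
  have K_iff: "(e, a, b) \<in> K \<longleftrightarrow>
      (e, a, b) \<in> out_arcs S \<or> (e, a, b) \<in> K1 \<or> (e, b, a) \<in> K2 \<or> (e, a, b) \<in> In" for e a b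
    by (auto simp: K_def)
  have out_Y: "a = u \<and> b \<noteq> u \<and> b \<in> Y" if "(e, a, b) \<in> out_arcs S" for e a b
    using that K1(2) by (auto simp: Bs_def)
  have R_off: "v \<noteq> u \<and> v \<notin> Y" if "v \<in> R" for v using that by (simp add: R_def)
  have out_K1: "(e, b, a) \<notin> K1" if "(e, a, b) \<in> out_arcs S" for e a b
    using that K1(1) by auto
  \<comment> \<open>The potentials exclude opposite arcs within \<open>K1\<close> and within
    \<open>K2\<close>, and \<open>orient_out S\<close> excludes reversed out-arcs from
    \<open>K1\<close>. Arcs of \<open>K2\<close> and \<open>In\<close> start outside
    \<open>Y\<close>, where \<open>K1\<close> stays, and \<open>K2\<close> avoids
    \<open>u\<close>.\<close>
  have "consistent K"
    unfolding consistent_def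
  proof (intro allI impI)
    fix e a b assume "(e, a, b) \<in> K \<and> (e, b, a) \<in> K"
    moreover have False if "(e, a, b) \<in> out_arcs S" "(e, b, a) \<in> K" for a b
      using that(2) out_Y[OF that(1)] out_Y[of e b a] out_K1[OF that(1)] K2_off[of e a b] R_off
      unfolding K_iff In_iff by blast
    moreover have False if "(e, a, b) \<in> K1" "(e, b, a) \<in> K1 \<or> (e, a, b) \<in> K2 \<or> (e, b, a) \<in> In" for a b
      using that(2) K1(3)[OF that(1)] K1(3)[of e b a] K2_off[of e a b] R_off[of b]
      unfolding In_iff by auto
    moreover have False if "(e, a, b) \<in> K2" "(e, b, a) \<in> K2 \<or> (e, a, b) \<in> In" for a b
      using that(2) K2(3)[OF that(1)] K2(3)[of e b a] K2_off[OF that(1)]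
      unfolding In_iff by auto
    moreover have False if "(e, a, b) \<in> In" "(e, b, a) \<in> In" for a b
      using that R_off unfolding In_iff by blast
    ultimately show "a = b" unfolding K_iff by blast
  qed
  have reach_u: "reach K (\<delta> y) y u" if "y \<in> Y" for y
    using K1(5)[OF that] reach_mono[of K1 _ y u K] by (auto simp: K_def)
  have reach_Y: "reach K (2 * r) u y" if y: "y \<in> Y" for y
  proof (cases "y = u")
    case False
    \<comment> \<open>The positive distance from \<open>y\<close> to \<open>u\<close> leaves room
      for the out-arc within \<open>2 * r\<close>.\<close>
    then have "\<delta> y > 0" using K1(4)[OF y] by simp
    then obtain b i where bi: "b \<in> Bs" "reach K1 i b y" "Suc i \<le> 2 * r"
      using K1(6)[OF y] by fastforce
    then obtain e where "(e, u, b) \<in> K" by (auto simp: Bs_def K_iff)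
    moreover have "reach K i b y" using reach_mono[OF bi(2), of K i] by (auto simp: K_def)
    ultimately have "reach K (Suc i) u y" by (rule reach_Cons)
    then show ?thesis using bi(3) by (rule reach_mono[OF _ subset_refl])
  qed simp
  have "reach K (4 * r - 1) u x \<and> reach K (2 * r) x u" if x: "x \<in> X" for x
  proof -
    consider "x = u" | "x \<in> Y" | "x \<in> Z" using x by (auto simp: X_def)
    then show ?thesis
    proof cases
      case 2
      then show ?thesis
        using reach_mono[OF reach_Y, of x K "4 * r - 1"] reach_mono[OF reach_u, of x K "2 * r"]
          \<delta>_le assms by auto
    next
      \<comment> \<open>From \<open>u\<close>, at most \<open>2 * r\<close> steps lead to
        \<open>t\<close> and \<open>2 * r - 1\<close> more to \<open>x\<close>. Back to
        \<open>u\<close>, at most \<open>2 * r - 1\<close> steps lead to a vertex of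
        \<open>R\<close>, and one arc of \<open>In\<close> follows.\<close>
      case 3
      have K2K: "reversal K2 \<subseteq> K" by (auto simp: K_def)
      obtain v i where vi: "v \<in> R" "reach K2 i v x" "i + \<epsilon> x \<le> 2 * r - 1"
        using K2(6)[OF 3] by blast
      obtain t where t: "t \<in> Y" "reach K2 (\<epsilon> x) x t" using K2(5)[OF 3] by blast
      have "reach K (\<epsilon> x) t x" using t reach_mono[OF _ K2K, of "\<epsilon> x" t x] by simp
      then have "reach K (2 * r + \<epsilon> x) u x" using reach_trans reach_Y t by fast
      moreover obtain e where "(e, v, u) \<in> K" using R_in[OF vi(1)] vi(1) by (auto simp: K_iff In_iff)
      moreover have "reach K i x v" using vi reach_mono[OF _ K2K, of i x v] by simp
      ultimately show ?thesis
        using reach_snoc[of K i x v e u] reach_mono[of K "Suc i" x u K "2 * r"]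
          reach_mono[of K "2 * r + \<epsilon> x" u x K "4 * r - 1"] vi(3) assms by auto
    qed simp
  qed
  moreover have "K \<subseteq> M"
    using K1(1) K2_off unfolding K_def reversal_def In_def out_arcs_def orient_out_def by blast
  moreover have "\<forall>e a b. (e, a, b) \<in> K \<longrightarrow> a \<in> X \<and> b \<in> X"
    using out_Y K1(3) K2(2,3) by (auto simp: K_iff In_iff X_def)
  moreover have "\<forall>e a b. (e, a, b) \<in> M \<and> (a = u \<or> b = u) \<longrightarrow> a \<in> X \<and> b \<in> X"
    using K2(2) by (auto simp: X_def R_def)
  moreover have "u \<in> X" by (simp add: X_def)
  ultimately show ?thesis using \<open>consistent K\<close> by blast
qed

end

section \<open>Contracting the absorbed set\<close>

definition contract :: "'v set \<Rightarrow> 'v \<Rightarrow> 'v \<Rightarrow> 'v" where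
  "contract X u w = (if w \<in> X then u else w)"

definition contract_arcs :: "'v set \<Rightarrow> 'v \<Rightarrow> ('v, 'e) arcs \<Rightarrow> ('v, 'e) arcs" where
  "contract_arcs X u M = {(e, contract X u a, contract X u b) | e a b. (e, a, b) \<in> M}"

text \<open>Arcs inside \<open>X\<close> become loops under contraction, so they must not be lifted.\<close>

definition lift_arcs :: "'v set \<Rightarrow> 'v \<Rightarrow> ('v, 'e) arcs \<Rightarrow> ('v, 'e) arcs \<Rightarrow> ('v, 'e) arcs" where
  "lift_arcs X u M K = {(e, a, b) \<in> M. (e, contract X u a, contract X u b) \<in> K \<and>
     contract X u a \<noteq> contract X u b}"

lemma reversal_contract_arcs: "reversal (contract_arcs X u M) = contract_arcs X u (reversal M)"
  by (auto simp: contract_arcs_def reversal_def)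

lemma reversal_lift_arcs: "reversal (lift_arcs X u M K) = lift_arcs X u (reversal M) (reversal K)"
  by (auto simp: lift_arcs_def reversal_def)

lemma contract_arcsI: "(e, a, b) \<in> M \<Longrightarrow> (e, contract X u a, contract X u b) \<in> contract_arcs X u M"
  by (auto simp: contract_arcs_def)

lemma reach_contract_arcs:
  "reach M n a b \<Longrightarrow> reach (contract_arcs X u M) n (contract X u a) (contract X u b)"
  by (induction n arbitrary: a) (auto intro: contract_arcsI)

text \<open>Lift the walk, skipping loops, until it first meets \<open>X\<close>; from there
  \<open>L\<close> leads to \<open>u\<close>, so \<open>d\<close> is paid only once.\<close>

lemma reach_lift_arcs:
  assumes "K \<subseteq> contract_arcs X u M" "u \<in> X" "\<And>x. x \<in> X \<Longrightarrow> reach L d x u"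
    and "reach K n (contract X u w) u"
  shows "reach (L \<union> lift_arcs X u M K) (n + d) w u"
  using assms(4)
proof (induction n arbitrary: w)
  case 0
  then have "w \<in> X" using assms(2) by (auto simp: contract_def split: if_splits)
  then show ?case using assms(3) reach_mono[of L d w u "L \<union> lift_arcs X u M K" d] by simp
next
  case (Suc n)
  show ?case
  proof (cases "w \<in> X")
    case True
    then show ?thesis
      using assms(3) reach_mono[of L d w u "L \<union> lift_arcs X u M K" "Suc n + d"] by simp
  next
    case False
    then have w: "contract X u w = w" "w \<noteq> u" using assms(2) by (auto simp: contract_def)
    then obtain e q where q: "(e, w, q) \<in> K" "reach K n q u" using Suc.prems by auto
    then obtain a b where ab: "(e, a, b) \<in> M" "contract X u a = w" "contract X u b = q"
      using assms(1) by (force simp: contract_arcs_def)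
    then have "a = w" using w by (auto simp: contract_def split: if_splits)
    have IH: "reach (L \<union> lift_arcs X u M K) (n + d) x u" if "contract X u x = q" for x
      using Suc.IH[of x] q(2) that by simp
    show ?thesis
    proof (cases "q = w")
      case True
      then show ?thesis using reach_mono[OF IH[of w] subset_refl, of "Suc n + d"] w by simp
    next
      case False
      then have "(e, w, b) \<in> L \<union> lift_arcs X u M K"
        using ab q \<open>a = w\<close> w by (auto simp: lift_arcs_def)
      then show ?thesis using reach_Cons[OF _ IH[OF ab(3)]] by simp
    qed
  qed
qed

text \<open>All arcs at \<open>u\<close> lie inside \<open>X\<close>, so the first step of a walk
  from \<open>u\<close> and the last step of a walk to \<open>u\<close> are saved. Walks avoiding an
  edge still avoid it after contraction.\<close>

lemma (in rooted_mixed) rooted_mixed_contract: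
  assumes "r = Suc k" "u \<in> X"
    and "\<And>e a b. (e, a, b) \<in> M \<Longrightarrow> a = u \<or> b = u \<Longrightarrow> a \<in> X \<and> b \<in> X"
  shows "rooted_mixed (contract_arcs X u M) (contract X u ` V) u k"
proof
  let ?c = "contract X u"
  have cu: "?c u = u" by (simp add: contract_def)
  have "contract_arcs X u M = (\<lambda>(e, a, b). (e, ?c a, ?c b)) ` M"
    by (force simp: contract_arcs_def)
  then show "finite (contract_arcs X u M)" using finite_arcs by simp
  show "u \<in> ?c ` V" using root cu by (metis imageI)
  show "a \<in> ?c ` V \<and> b \<in> ?c ` V" if "(e, a, b) \<in> contract_arcs X u M" for e a b
    using that arc_ends by (auto simp: contract_arcs_def)
  show "(a', b') = (a, b) \<or> (a', b') = (b, a)"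
    if arcs: "(e, a, b) \<in> contract_arcs X u M" "(e, a', b') \<in> contract_arcs X u M" for e a b a' b'
    using arcs mixed by (auto simp: contract_arcs_def) blast+
  show "reach (contract_arcs X u M) k u w" if w: "w \<in> ?c ` V" for w
  proof -
    obtain w0 where w0: "w0 \<in> V" "w = ?c w0" using w by blast
    show ?thesis
    proof (cases "u = w0")
      case False
      then obtain e c where c: "(e, u, c) \<in> M" "reach M k c w0"
        using out_ecc[OF w0(1)] assms(1) by auto
      then have "?c c = u" using assms(3) by (auto simp: contract_def)
      then show ?thesis using reach_contract_arcs[OF c(2), of X u] w0 by simp
    qed (use w0 cu in auto)
  qed
  show "reach (contract_arcs X u M) k w u" if w: "w \<in> ?c ` V" for w
  proof -
    obtain w0 where w0: "w0 \<in> V" "w = ?c w0" using w by blast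
    show ?thesis
    proof (cases "u = w0")
      case False
      have "reach (reversal M) (Suc k) u w0"
        using in_ecc[OF w0(1)] unfolding assms(1) reach_reversal .
      then obtain e c where "(e, c, u) \<in> M" "reach (reversal M) k c w0"
        using False by (auto simp del: reach_reversal)
      then have c: "(e, c, u) \<in> M" "reach M k w0 c" by simp_all
      then have "?c c = u" using assms(3) by (auto simp: contract_def)
      then show ?thesis using reach_contract_arcs[OF c(2), of X u] w0 by simp
    qed (use w0 cu in auto)
  qed
  show "\<exists>n. reach (avoid_edge (contract_arcs X u M) e) n p q"
    if arcs: "(e, p, q) \<in> contract_arcs X u M" "(e, q, p) \<in> contract_arcs X u M" for e p q
  proof -
    obtain a b a' b' where ab: "(e, a, b) \<in> M" "p = ?c a" "q = ?c b"
      "(e, a', b') \<in> M" "q = ?c a'" "p = ?c b'"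
      using arcs by (auto simp: contract_arcs_def)
    show ?thesis
    proof (cases "p = q")
      case False
      then have "(e, b, a) \<in> M" using mixed[OF ab(1,4)] ab by auto
      then obtain n where "reach (avoid_edge M e) n a b" using no_bridge ab(1) by blast
      moreover have "contract_arcs X u (avoid_edge M e) = avoid_edge (contract_arcs X u M) e"
        by (auto simp: contract_arcs_def avoid_edge_def)
      ultimately show ?thesis using reach_contract_arcs[of "avoid_edge M e" n a b X u] ab by auto
    qed simp
  qed
qed

section \<open>Induction on the eccentricity\<close>

lemma (in rooted_mixed) absorb_neighbourhood_flipped:
  assumes "0 < r"
  shows "\<exists>K X. K \<subseteq> M \<and> u \<in> X \<and> consistent K \<and>
    (\<forall>e a b. (e, a, b) \<in> K \<longrightarrow> a \<in> X \<and> b \<in> X) \<and>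
    (\<forall>e a b. (e, a, b) \<in> M \<and> (a = u \<or> b = u) \<longrightarrow> a \<in> X \<and> b \<in> X) \<and>
    (\<forall>x\<in>X. reach K (2 * r) u x \<and> reach K (4 * r - 1) x u)"
proof -
  interpret rev: rooted_mixed "reversal M" V u r by (rule rooted_mixed_reversal)
  from rev.absorb_neighbourhood[OF assms] obtain K X where K: "K \<subseteq> reversal M" "u \<in> X" "consistent K"
    "\<forall>e a b. (e, a, b) \<in> K \<longrightarrow> a \<in> X \<and> b \<in> X"
    "\<forall>e a b. (e, a, b) \<in> reversal M \<and> (a = u \<or> b = u) \<longrightarrow> a \<in> X \<and> b \<in> X"
    "\<forall>x\<in>X. reach K (4 * r - 1) u x \<and> reach K (2 * r) x u" by blast
  have "\<forall>e a b. (e, a, b) \<in> M \<and> (a = u \<or> b = u) \<longrightarrow> a \<in> X \<and> b \<in> X"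
    using K(5) unfolding reversal_iff by blast
  moreover have "\<forall>e a b. (e, a, b) \<in> reversal K \<longrightarrow> a \<in> X \<and> b \<in> X"
    using K(4) unfolding reversal_iff by blast
  moreover have "reversal K \<subseteq> M" "consistent (reversal K)"
    using reversal_mono[OF K(1)] K(3) by (simp_all add: consistent_reversal)
  moreover have "\<forall>x\<in>X. reach (reversal K) (2 * r) u x \<and> reach (reversal K) (4 * r - 1) x u"
    using K(6) by simp
  ultimately show ?thesis using K(2) by blast
qed

text \<open>\<open>c\<close> selects the layers whose larger cost is charged to the distances from
  \<open>u\<close>. Costs add up over the contractions; \<open>L\<close> lies inside
  \<open>X\<close> and no lifted arc does, so the union stays consistent.\<close>

lemma rooted_orientation:
  assumes "rooted_mixed M V u r"
  shows "\<exists>K\<subseteq>M. consistent K \<and>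
    (\<forall>w\<in>V. reach K (\<Sum>i=1..r. if c i then 4 * i - 1 else 2 * i) u w \<and>
            reach K (\<Sum>i=1..r. if c i then 2 * i else 4 * i - 1) w u)"
  using assms
proof (induction r arbitrary: M V)
  case 0
  then interpret rooted_mixed M V u 0 .
  show ?case using out_ecc by (intro exI[of _ "{}"]) (auto simp: consistent_def)
next
  case (Suc k)
  then interpret rooted_mixed M V u "Suc k" by simp
  define d where "d = (if c (Suc k) then 4 * Suc k - 1 else 2 * Suc k)"
  define d' where "d' = (if c (Suc k) then 2 * Suc k else 4 * Suc k - 1)"
  define D where "D = (\<Sum>i=1..k. if c i then 4 * i - 1 else 2 * i)"
  define D' where "D' = (\<Sum>i=1..k. if c i then 2 * i else 4 * i - 1)"
  have "\<exists>L X. L \<subseteq> M \<and> u \<in> X \<and> consistent L \<and>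
    (\<forall>e a b. (e, a, b) \<in> L \<longrightarrow> a \<in> X \<and> b \<in> X) \<and>
    (\<forall>e a b. (e, a, b) \<in> M \<and> (a = u \<or> b = u) \<longrightarrow> a \<in> X \<and> b \<in> X) \<and>
    (\<forall>x\<in>X. reach L d u x \<and> reach L d' x u)"
    using absorb_neighbourhood absorb_neighbourhood_flipped by (cases "c (Suc k)") (simp_all add: d_def d'_def)
  then obtain L X where L: "L \<subseteq> M" "u \<in> X" "consistent L"
    "\<forall>e a b. (e, a, b) \<in> L \<longrightarrow> a \<in> X \<and> b \<in> X"
    "\<forall>e a b. (e, a, b) \<in> M \<and> (a = u \<or> b = u) \<longrightarrow> a \<in> X \<and> b \<in> X"
    "\<forall>x\<in>X. reach L d u x \<and> reach L d' x u"
    by (elim exE conjE) (rule that)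
  have nbrs: "a \<in> X \<and> b \<in> X" if "(e, a, b) \<in> M" "a = u \<or> b = u" for e a b
    using L(5) that by blast
  have L_ecc: "reach L d u x" "reach L d' x u" if "x \<in> X" for x
    using L(6) that by simp_all
  have "rooted_mixed (contract_arcs X u M) (contract X u ` V) u k"
    using rooted_mixed_contract[OF refl L(2) nbrs] .
  from Suc.IH[OF this] obtain K where K: "K \<subseteq> contract_arcs X u M" "consistent K"
    "\<forall>w\<in>contract X u ` V. reach K D u w \<and> reach K D' w u"
    unfolding D_def D'_def by blast
  have K_ecc: "reach K D u (contract X u w)" "reach K D' (contract X u w) u" if "w \<in> V" for w
    using K(3) that by simp_all
  let ?K = "L \<union> lift_arcs X u M K"
  have "consistent ?K"
    unfolding consistent_def
  proof (intro allI impI)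
    fix e a b assume "(e, a, b) \<in> ?K \<and> (e, b, a) \<in> ?K"
    moreover have "(e, a, b) \<notin> lift_arcs X u M K" if "a \<in> X" "b \<in> X" for a b
      using that by (simp add: lift_arcs_def contract_def)
    moreover have "(e, b, a) \<notin> lift_arcs X u M K" if "(e, a, b) \<in> lift_arcs X u M K"
      using that K(2) unfolding lift_arcs_def consistent_def by blast
    ultimately show "a = b" using L(3,4) unfolding consistent_def by blast
  qed
  moreover have "reach ?K (D + d) u w" if "w \<in> V" for w
  proof -
    \<comment> \<open>\<open>reach_lift_arcs\<close> treats walks ending at \<open>u\<close>; those
      starting there follow by reversal.\<close>
    have "reach (reversal L \<union> lift_arcs X u (reversal M) (reversal K)) (D + d) w u"
      using reversal_mono[OF K(1)] K_ecc(1)[OF that] L(2) L_ecc(1)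
      by (intro reach_lift_arcs) (auto simp: reversal_contract_arcs)
    moreover have "reversal L \<union> lift_arcs X u (reversal M) (reversal K) = reversal ?K"
      unfolding reversal_lift_arcs[symmetric] by (auto simp: reversal_def)
    ultimately show ?thesis by simp
  qed
  moreover have "reach ?K (D' + d') w u" if "w \<in> V" for w
    using reach_lift_arcs[OF K(1) L(2) L_ecc(2) K_ecc(2)[OF that]] .
  moreover have "?K \<subseteq> M" using L(1) by (auto simp: lift_arcs_def)
  ultimately show ?case
    unfolding D_def D'_def d_def d'_def by (intro exI[of _ ?K]) simp
qed

text \<open>
  The costs \<open>4 i - 1\<close> and \<open>2 i\<close> differ by the odd number \<open>2 i - 1\<close>, so the layers have to be split
  into two classes with nearly equal sums of odd numbers. Four consecutive odd numbers split
  evenly, the two extreme ones against the two middle ones.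
\<close>

lemma balanced_layers:
  "\<exists>c. 2 * (\<Sum>i=1..r. if c i then 4 * i - 1 else 2 * i) \<le> 3 * r ^ 2 + 2 * r + 2 \<and>
       2 * (\<Sum>i=1..r. if c i then 2 * i else 4 * i - 1) \<le> 3 * r ^ 2 + 2 * r + (2 :: nat)"
proof (induction r rule: less_induct)
  case (less r)
  show ?case
  proof (cases "r < 4")
    case True
    \<comment> \<open>The two sums add up to \<open>3 * r ^ 2 + 2 * r\<close>, so they may differ by
      at most 2. Setting the last layer against all others leaves differences 0, 1, 2, 1.\<close>
    then have "r = 0 \<or> r = Suc 0 \<or> r = Suc (Suc 0) \<or> r = Suc (Suc (Suc 0))" by linarith
    then show ?thesis
      by (intro exI[of _ "\<lambda>i. i = r"]) (elim disjE; simp add: power2_eq_square)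
  next
    case False
    then have "r = Suc (Suc (Suc (Suc (r - 4))))" by simp
    then obtain s where s: "r = Suc (Suc (Suc (Suc s)))" by blast
    from less[of s] s obtain c where
      c: "2 * (\<Sum>i=1..s. if c i then 4 * i - 1 else 2 * i) \<le> 3 * s ^ 2 + 2 * s + 2"
        "2 * (\<Sum>i=1..s. if c i then 2 * i else 4 * i - 1) \<le> 3 * s ^ 2 + 2 * s + 2" by auto
    define c' where "c' i = (if i \<le> s then c i else i = Suc s \<or> i = r)" for i
    have "(\<Sum>i=1..s. if c' i then 4 * i - 1 else 2 * i) = (\<Sum>i=1..s. if c i then 4 * i - 1 else 2 * i)"
      "(\<Sum>i=1..s. if c' i then 2 * i else 4 * i - 1) = (\<Sum>i=1..s. if c i then 2 * i else 4 * i - 1)"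
      by (auto intro!: sum.cong simp: c'_def)
    moreover have "c' (Suc s)" "\<not> c' (Suc (Suc s))" "\<not> c' (Suc (Suc (Suc s)))" "c' r"
      by (auto simp: c'_def s)
    ultimately show ?thesis
      using c by (intro exI[of _ c']) (simp add: s power2_eq_square)
  qed
qed

section \<open>Mixed multigraphs\<close>

definition arcs_of :: "('v, 'e) pre_mixed_multigraph \<Rightarrow> ('v, 'e) arcs" where
  "arcs_of G = {(e, a, b). traverses G e a b}"

lemma arcs_of_iff [simp]: "(e, a, b) \<in> arcs_of G \<longleftrightarrow> traverses G e a b"
  by (simp add: arcs_of_def)

section \<open>Walks, paths and distances\<close>

lemma is_walk_Cons:
  "is_walk G (a # vs) (e # es) \<longleftrightarrow>
     a \<in> verts G \<and> vs \<noteq> [] \<and> traverses G e a (hd vs) \<and> is_walk G vs es"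
  by (cases vs) (auto simp: is_walk_def All_less_Suc2 nth_Cons split: nat.splits)

lemma reach_of_walk: "is_walk G vs es \<Longrightarrow> reach (arcs_of G) (length es) (hd vs) (last vs)"
proof (induction es arbitrary: vs)
  case Nil
  then show ?case by (cases vs) (auto simp: is_walk_def)
next
  case (Cons e es)
  then obtain a ws where vs: "vs = a # ws" by (cases vs) (auto simp: is_walk_def)
  with Cons show ?case by (auto simp: is_walk_Cons)
qed

lemma reach_of_path: "path_from_to G u vs es v \<Longrightarrow> reach (arcs_of G) (length es) u v"
  using reach_of_walk[of G vs es] by (auto simp: path_from_to_def is_path_def is_trail_def)

lemma is_walk_drop: "is_walk G vs es \<Longrightarrow> i < length vs \<Longrightarrow> is_walk G (drop i vs) (drop i es)"
  by (auto simp: is_walk_def dest: in_set_dropD)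

text \<open>If the new first vertex already occurs on the walk, the walk is cut back to start there,
  which keeps the vertices distinct.\<close>

lemma walk_of_reach:
  assumes "reach (arcs_of G) n u v" "v \<in> verts G"
    and "\<And>e a b. traverses G e a b \<Longrightarrow> a \<in> verts G"
  shows "\<exists>vs es. is_walk G vs es \<and> distinct vs \<and> hd vs = u \<and> last vs = v \<and> length es \<le> n"
  using assms(1)
proof (induction n arbitrary: u)
  case 0
  then show ?case using assms(2) by (intro exI[of _ "[u]"] exI[of _ "[]"]) (simp add: is_walk_def)
next
  case (Suc n)
  show ?case
  proof (cases "u = v")
    case True
    then show ?thesis using assms(2) by (intro exI[of _ "[u]"] exI[of _ "[]"]) (simp add: is_walk_def)
  next
    case False
    then obtain e c where c: "traverses G e u c" "reach (arcs_of G) n c v" using Suc.prems by auto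
    from Suc.IH[OF c(2)] obtain vs es where
      vs: "is_walk G vs es" "distinct vs" "hd vs = c" "last vs = v" "length es \<le> n" by blast
    show ?thesis
    proof (cases "u \<in> set vs")
      case True
      then obtain i where i: "i < length vs" "vs ! i = u" by (auto simp: in_set_conv_nth)
      then show ?thesis using vs is_walk_drop[OF vs(1) i(1)]
        by (intro exI[of _ "drop i vs"] exI[of _ "drop i es"]) (simp add: hd_drop_conv_nth)
    next
      case False
      have "vs \<noteq> []" using vs(1) by (auto simp: is_walk_def)
      then show ?thesis using vs c assms(3) False
        by (intro exI[of _ "u # vs"] exI[of _ "e # es"]) (auto simp: is_walk_Cons)
    qed
  qed
qed

text \<open>In a directed multigraph an edge determines its tail, so a walk without repeated
  vertices repeats no edge.\<close>

lemma path_of_reach: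
  assumes "reach (arcs_of H) n u v" "v \<in> verts H" "uedges H = {}"
    and "\<And>e. e \<in> darcs H \<Longrightarrow> tail H e \<in> verts H"
  shows "\<exists>vs es. path_from_to H u vs es v \<and> length es \<le> n"
proof -
  obtain vs es where vs: "is_walk H vs es" "distinct vs" "hd vs = u" "last vs = v" "length es \<le> n"
    using walk_of_reach[OF assms(1,2)] assms(3,4) by (auto simp: traverses_def)
  have "distinct es"
    unfolding distinct_conv_nth
  proof (intro allI impI)
    fix i j assume ij: "i < length es" "j < length es" "i \<noteq> j"
    then have "tail H (es ! i) = vs ! i" "tail H (es ! j) = vs ! j"
      using vs(1) assms(3) by (auto simp: is_walk_def traverses_def)
    moreover have "vs ! i \<noteq> vs ! j" using vs(1,2) ij by (simp add: is_walk_def nth_eq_iff_index_eq)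
    ultimately show "es ! i \<noteq> es ! j" by metis
  qed
  then have "path_from_to H u vs es v"
    using vs by (simp add: path_from_to_def is_path_def is_trail_def distinct_butlast distinct_tl)
  then show ?thesis using vs(5) by blast
qed

lemma reach_of_distance:
  assumes "distance G u v \<le> enat r"
  shows "reach (arcs_of G) r u v"
proof -
  let ?A = "{enat (length es) | vs es. path_from_to G u vs es v}"
  have "?A \<noteq> {}"
  proof
    assume "?A = {}"
    then have "distance G u v = top" unfolding distance_def by (simp only: Inf_empty)
    then show False using assms by (simp add: top_enat_def)
  qed
  then have "distance G u v \<in> ?A" unfolding distance_def by (meson ex_in_conv wellorder_InfI)
  then show ?thesis using assms reach_of_path reach_mono by fastforce
qed

section \<open>Translation between graphs and arc sets\<close>

text \<open>The radius is attained at some \<open>u\<close>. An edge with arcs both ways between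
  distinct vertices is undirected and, not being a bridge, can be bypassed.\<close>

lemma rooted_mixed_arcs_of:
  fixes G :: "('v, 'e) pre_mixed_multigraph"
  assumes "mixed_multigraph G" "bridgeless G" "radius G = enat r"
  shows "\<exists>u. rooted_mixed (arcs_of G) (verts G) u r"
proof -
  interpret mixed_multigraph G by fact
  have "radius G \<in> eccentricity G ` verts G"
    unfolding radius_def using verts_nonempty by (meson ex_in_conv image_is_empty wellorder_InfI)
  then obtain u where u: "u \<in> verts G" "eccentricity G u = enat r" using assms(3) by auto
  have ends: "a \<in> verts G \<and> b \<in> verts G" if "traverses G e a b" for e a b
    using that ends_in_verts[of e] tail_in_verts[of e] head_in_verts[of e]
    by (auto simp: traverses_def doubleton_eq_iff)
  have "rooted_mixed (arcs_of G) (verts G) u r"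
  proof
    have "arcs_of G \<subseteq> (darcs G \<union> uedges G) \<times> verts G \<times> verts G"
      using ends by (auto simp: traverses_def arcs_of_def)
    then show "finite (arcs_of G)"
      using verts_finite darcs_finite uedges_finite by (auto intro: finite_subset)
    show "u \<in> verts G" by fact
    show "a \<in> verts G \<and> b \<in> verts G" if "(e, a, b) \<in> arcs_of G" for e a b
      using that ends by simp
    show "(a', b') = (a, b) \<or> (a', b') = (b, a)"
      if "(e, a, b) \<in> arcs_of G" "(e, a', b') \<in> arcs_of G" for e a b a' b'
      using that darcs_uedges_disjoint by (auto simp: traverses_def doubleton_eq_iff)
    show "reach (arcs_of G) r u w" if "w \<in> verts G" for w
    proof (rule reach_of_distance)
      have "distance G u w \<le> eccentricity G u"
        unfolding eccentricity_def using that by (meson SUP_upper max.coboundedI1)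
      then show "distance G u w \<le> enat r" using u by simp
    qed
    show "reach (arcs_of G) r w u" if "w \<in> verts G" for w
    proof (rule reach_of_distance)
      have "distance G w u \<le> eccentricity G u"
        unfolding eccentricity_def
        by (rule max.coboundedI2) (rule SUP_upper[OF that, of "\<lambda>v. distance G v u"])
      then show "distance G w u \<le> enat r" using u by simp
    qed
    show "\<exists>n. reach (avoid_edge (arcs_of G) e) n a b"
      if e: "(e, a, b) \<in> arcs_of G" "(e, b, a) \<in> arcs_of G" for e a b
    proof (cases "a = b")
      case False
      then have "e \<in> uedges G" using e by (auto simp: traverses_def)
      then have "strongly_connected (del_uedge G e)"
        using assms(2) by (auto simp: bridgeless_def is_bridge_def)
      moreover have verts_del: "verts (del_uedge G e) = verts G" by (simp add: del_uedge_def)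
      ultimately obtain vs es where "path_from_to (del_uedge G e) a vs es b"
        using False ends[of e a b] e(1) verts_del by (metis arcs_of_iff strongly_connected_def)
      then have "reach (arcs_of (del_uedge G e)) (length es) a b" by (rule reach_of_path)
      moreover have "arcs_of (del_uedge G e) \<subseteq> avoid_edge (arcs_of G) e"
        using \<open>e \<in> uedges G\<close> darcs_uedges_disjoint
        by (auto simp: arcs_of_def avoid_edge_def traverses_def del_uedge_def)
      ultimately have "reach (avoid_edge (arcs_of G) e) (length es) a b"
        by (rule reach_mono) simp
      then show ?thesis ..
    qed simp
  qed
  then show ?thesis ..
qed

lemma orientation_of_consistent:
  fixes G :: "('v, 'e) pre_mixed_multigraph"
  assumes "mixed_multigraph G" "K \<subseteq> arcs_of G" "consistent K"
  shows "\<exists>H. is_orientation G H \<and> K \<subseteq> arcs_of H \<and> (\<forall>e\<in>darcs H. tail H e \<in> verts H)"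
proof -
  interpret mixed_multigraph G by fact
  \<comment> \<open>\<open>p\<close> lists tail and head for \<open>e\<close>: dictated by
    \<open>K\<close> if \<open>K\<close> uses \<open>e\<close>, arbitrary otherwise.\<close>
  have "\<exists>p. ends G e = {fst p, snd p} \<and> (\<forall>a b. (e, a, b) \<in> K \<longrightarrow> p = (a, b))"
    if e: "e \<in> uedges G" for e
  proof (cases "\<exists>a b. (e, a, b) \<in> K")
    case True
    then obtain a b where ab: "(e, a, b) \<in> K" by blast
    have K_ends: "ends G e = {x, y}" if "(e, x, y) \<in> K" for x y
      using that assms(2) e darcs_uedges_disjoint by (fastforce simp: traverses_def)
    have "(x, y) = (a, b)" if "(e, x, y) \<in> K" for x y
      using K_ends[OF ab] K_ends[OF that] ab that assms(3)
      unfolding consistent_def by (metis doubleton_eq_iff)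
    then show ?thesis using K_ends[OF ab] by (intro exI[of _ "(a, b)"]) auto
  next
    case False
    then show ?thesis using ends_in_verts[OF e] by fastforce
  qed
  then obtain p where p: "\<And>e. e \<in> uedges G \<Longrightarrow> ends G e = {fst (p e), snd (p e)}"
    "\<And>e a b. e \<in> uedges G \<Longrightarrow> (e, a, b) \<in> K \<Longrightarrow> p e = (a, b)" by metis
  define H where "H = G\<lparr>darcs := darcs G \<union> uedges G, uedges := {},
    tail := \<lambda>e. if e \<in> darcs G then tail G e else fst (p e),
    head := \<lambda>e. if e \<in> darcs G then head G e else snd (p e)\<rparr>"
  have "is_orientation G H"
    using p(1) darcs_uedges_disjoint by (auto simp: is_orientation_def H_def)
  moreover have "K \<subseteq> arcs_of H"
  proof clarify
    fix e a b assume e: "(e, a, b) \<in> K"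
    then show "(e, a, b) \<in> arcs_of H"
      using assms(2) p(2)[OF _ e] darcs_uedges_disjoint by (fastforce simp: traverses_def H_def)
  qed
  moreover have "tail H e \<in> verts H" if "e \<in> darcs H" for e
    using that tail_in_verts[of e] ends_in_verts[of e] p(1)[of e]
    by (auto simp: H_def doubleton_eq_iff)
  ultimately show ?thesis by blast
qed

lemma radius_le:
  assumes "u \<in> verts H" "\<And>w. w \<in> verts H \<Longrightarrow> distance H u w \<le> n \<and> distance H w u \<le> n"
  shows "radius H \<le> n"
proof -
  have "eccentricity H u \<le> n" unfolding eccentricity_def using assms(2) by (simp add: SUP_le_iff)
  then show ?thesis unfolding radius_def using assms(1) by (meson INF_lower2)
qed

lemma oriented_radius_le:
  fixes G :: "('v, 'e) pre_mixed_multigraph"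
  assumes "mixed_multigraph G" "bridgeless G" "radius G = enat r"
  shows "\<exists>H. is_orientation G H \<and> strongly_connected H \<and>
    radius H \<le> enat ((3 * r ^ 2 + 2 * r + 2) div 2)"
proof -
  \<comment> \<open>Lengths are integers, so the bound may be rounded down.\<close>
  let ?n = "(3 * r ^ 2 + 2 * r + 2) div 2"
  obtain u where rooted: "rooted_mixed (arcs_of G) (verts G) u r"
    using rooted_mixed_arcs_of assms by blast
  obtain c where c: "2 * (\<Sum>i=1..r. if c i then 4 * i - 1 else 2 * i) \<le> 3 * r ^ 2 + 2 * r + 2"
    "2 * (\<Sum>i=1..r. if c i then 2 * i else 4 * i - 1) \<le> 3 * r ^ 2 + 2 * r + 2"
    using balanced_layers by blast
  obtain K where K: "K \<subseteq> arcs_of G" "consistent K"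
    "\<And>w. w \<in> verts G \<Longrightarrow> reach K (\<Sum>i=1..r. if c i then 4 * i - 1 else 2 * i) u w"
    "\<And>w. w \<in> verts G \<Longrightarrow> reach K (\<Sum>i=1..r. if c i then 2 * i else 4 * i - 1) w u"
    using rooted_orientation[OF rooted, of c] by blast
  obtain H where H: "is_orientation G H" "K \<subseteq> arcs_of H" "\<forall>e\<in>darcs H. tail H e \<in> verts H"
    using orientation_of_consistent[OF assms(1) K(1,2)] by blast
  have verts: "verts H = verts G" "uedges H = {}" using H(1) by (auto simp: is_orientation_def)
  have u: "u \<in> verts H" using rooted verts by (simp add: rooted_mixed.root)
  have to: "reach (arcs_of H) ?n u w" if "w \<in> verts H" for w
  proof (rule reach_mono[OF K(3) H(2)])
    show "w \<in> verts G" using that verts by simp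
  qed (use c(1) in linarith)
  have fro: "reach (arcs_of H) ?n w u" if "w \<in> verts H" for w
  proof (rule reach_mono[OF K(4) H(2)])
    show "w \<in> verts G" using that verts by simp
  qed (use c(2) in linarith)
  have path: "\<exists>vs es. path_from_to H a vs es b \<and> length es \<le> n"
    if "reach (arcs_of H) n a b" "b \<in> verts H" for n a b
    using path_of_reach[OF that verts(2)] H(3) by blast
  have dist: "distance H a b \<le> enat n"
    if ab: "reach (arcs_of H) n a b" "b \<in> verts H" for n a b
  proof -
    obtain vs es where "path_from_to H a vs es b" "length es \<le> n" using path[OF ab] by blast
    then show ?thesis unfolding distance_def by (intro Inf_lower2[of "enat (length es)"]) auto
  qed
  have "strongly_connected H"
    unfolding strongly_connected_def using path reach_trans[OF fro to] by blast
  moreover have "radius H \<le> enat ?n" using radius_le[OF u] dist to fro u by blast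
  ultimately show ?thesis using H(1) by blast
qed

theorem theorem3:
  fixes r :: nat
  shows "ereal_of_enat (oriented_radius_bound r) \<le> ereal (3 / 2 * real r ^ 2 + real r + 1) \<and>
    (\<forall>G :: ('v, 'e) pre_mixed_multigraph.
       mixed_multigraph G \<and> strongly_connected G \<and> bridgeless G \<and> radius G = enat r \<longrightarrow>
       (\<exists>H. is_orientation G H \<and> strongly_connected H \<and>
            ereal_of_enat (radius H) \<le> ereal (3 / 2 * real r ^ 2 + real r + 1)))"
proof -
  let ?n = "(3 * r ^ 2 + 2 * r + 2) div 2"
  have "real ?n \<le> real (3 * r ^ 2 + 2 * r + 2) / 2"
    using of_nat_div_le_of_nat[of "3 * r ^ 2 + 2 * r + 2" 2] by simp
  then have "real ?n \<le> 3 / 2 * real r ^ 2 + real r + 1" by (simp add: field_simps)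
  then have bound: "ereal_of_enat x \<le> ereal (3 / 2 * real r ^ 2 + real r + 1)" if "x \<le> enat ?n" for x
    using that by (cases x) auto
  \<comment> \<open>\<open>?n\<close> belongs to the set whose infimum is taken, by
    \<open>oriented_radius_le\<close> for graphs on natural numbers.\<close>
  have "oriented_radius_bound r \<le> enat ?n"
    unfolding oriented_radius_bound_def using oriented_radius_le by (intro Inf_lower) blast
  then show ?thesis using bound oriented_radius_le by meson
qed

end
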